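(* Let $a,b,c,d$ be real numbers with $a+b=c+d$, let $n\ge 1$, and let $k_1,\dots,k_n$ be arbitrary real numbers. Define finite sequences $x^{(m)}=(x^{(m)}_1,\dots,x^{(m)}_{2^m})$ and $y^{(m)}=(y^{(m)}_1,\dots,y^{(m)}_{2^m})$ for $1\le m\le n$ recursively by $x^{(1)}=(a+k_1,\;b+k_1)$, $y^{(1)}=(c+k_1,\;d+k_1)$, and for $2\le m\le n$ and $1\le j\le 2^{m-1}$: $x^{(m)}_j=x^{(m-1)}_j$, $x^{(m)}_{2^{m-1}+j}=y^{(m-1)}_j+k_m$, $y^{(m)}_j=y^{(m-1)}_j$, $y^{(m)}_{2^{m-1}+j}=x^{(m-1)}_j+k_m$. Then $$\sum_{i=1}^{2^n}\bigl(x^{(n)}_i\bigr)^n=\sum_{i=1}^{2^n}\bigl(y^{(n)}_i\bigr)^n .$$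
   Context: All numbers are real. In words: the $x$-sequence at stage $m$ is the $x$-sequence of stage $m-1$ followed by the $y$-sequence of stage $m-1$ with $k_m$ added to each entry, and symmetrically for the $y$-sequence. *)

theory Defs
  imports Complex_Main
begin

text \<open>The finite sequences are lists, so the entry with (1-based) index \<open>j\<close> is
  \<open>xseq a b c d k m ! (j - 1)\<close>. The construction starts at stage 1; the value at stage 0 is a
  dummy. The parameters are \<open>k 1, k 2, \<dots>\<close>; stage \<open>m\<close> depends only on \<open>k 1, \<dots>, k m\<close>.\<close>

fun xseq :: "real \<Rightarrow> real \<Rightarrow> real \<Rightarrow> real \<Rightarrow> (nat \<Rightarrow> real) \<Rightarrow> nat \<Rightarrow> real list"
  and yseq :: "real \<Rightarrow> real \<Rightarrow> real \<Rightarrow> real \<Rightarrow> (nat \<Rightarrow> real) \<Rightarrow> nat \<Rightarrow> real list"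
where
  "xseq a b c d k 0 = []"
| "xseq a b c d k (Suc 0) = [a + k 1, b + k 1]"
| "xseq a b c d k (Suc (Suc m)) =
     xseq a b c d k (Suc m) @ map (\<lambda>t. t + k (Suc (Suc m))) (yseq a b c d k (Suc m))"
| "yseq a b c d k 0 = []"
| "yseq a b c d k (Suc 0) = [c + k 1, d + k 1]"
| "yseq a b c d k (Suc (Suc m)) =
     yseq a b c d k (Suc m) @ map (\<lambda>t. t + k (Suc (Suc m))) (xseq a b c d k (Suc m))"

lemma length_xseq_yseq:
  "m \<ge> 1 \<Longrightarrow> length (xseq a b c d k m) = 2 ^ m \<and> length (yseq a b c d k m) = 2 ^ m"
proof (induction m rule: nat_induct_at_least)
  case base
  then show ?case by simp
next
  case (Suc m)
  then show ?case by (cases m) auto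
qed

lemma xseq_yseq_nth:
  assumes "m \<ge> 2" and "1 \<le> j" and "j \<le> 2 ^ (m - 1)"
  shows "xseq a b c d k m ! (j - 1) = xseq a b c d k (m - 1) ! (j - 1)"
    and "xseq a b c d k m ! (2 ^ (m - 1) + j - 1) = yseq a b c d k (m - 1) ! (j - 1) + k m"
    and "yseq a b c d k m ! (j - 1) = yseq a b c d k (m - 1) ! (j - 1)"
    and "yseq a b c d k m ! (2 ^ (m - 1) + j - 1) = xseq a b c d k (m - 1) ! (j - 1) + k m"
proof -
  obtain l where m: "m = Suc (Suc l)"
    using \<open>m \<ge> 2\<close> by (metis One_nat_def Suc_1 Suc_le_D Suc_le_mono)
  have len: "length (xseq a b c d k (Suc l)) = 2 ^ Suc l"
    "length (yseq a b c d k (Suc l)) = 2 ^ Suc l"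
    using length_xseq_yseq[of "Suc l"] by auto
  obtain i where j: "j = Suc i" using \<open>1 \<le> j\<close> by (cases j) auto
  have i: "i < 2 ^ Suc l" using assms m j by simp
  show "xseq a b c d k m ! (j - 1) = xseq a b c d k (m - 1) ! (j - 1)"
    and "xseq a b c d k m ! (2 ^ (m - 1) + j - 1) = yseq a b c d k (m - 1) ! (j - 1) + k m"
    and "yseq a b c d k m ! (j - 1) = yseq a b c d k (m - 1) ! (j - 1)"
    and "yseq a b c d k m ! (2 ^ (m - 1) + j - 1) = xseq a b c d k (m - 1) ! (j - 1) + k m"
    using i len by (simp_all add: m j nth_append)
qed

end

theory Submission
  imports Defs
begin

text \<open>The equality of power sums holds for all exponents \<open>p \<le> n\<close>, not just for \<open>p = n\<close>; this
  stronger claim goes by induction on the stage. In the difference of the new power sums of exponent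
  \<open>p\<close>, expand the shifted entries binomially: the two contributions of the old power sums of
  exponent \<open>p\<close> itself cancel, so only the old power sums of exponent below \<open>p\<close> matter, and each
  stage gains one exponent.\<close>

lemma sum_list_power_shift:
  fixes t :: "'a::comm_semiring_1"
  shows "(\<Sum>x\<leftarrow>xs. (x + t) ^ p) = (\<Sum>j\<le>p. of_nat (p choose j) * t ^ (p - j) * (\<Sum>x\<leftarrow>xs. x ^ j))"
proof (induction xs)
  case Nil
  then show ?case by simp
next
  case (Cons x xs)
  then show ?case
    by (simp add: binomial_ring sum.distrib distrib_left mult_ac)
qed

lemma power_sums_eq_append_shift:
  fixes t :: "'a::comm_semiring_1"
  assumes eq: "\<And>j. j \<le> m \<Longrightarrow> (\<Sum>x\<leftarrow>xs. x ^ j) = (\<Sum>y\<leftarrow>ys. y ^ j)"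
    and p: "p \<le> Suc m"
  shows "(\<Sum>x\<leftarrow>xs @ map (\<lambda>u. u + t) ys. x ^ p) = (\<Sum>y\<leftarrow>ys @ map (\<lambda>u. u + t) xs. y ^ p)"
proof -
  have lower: "(\<Sum>j<p. of_nat (p choose j) * t ^ (p - j) * (\<Sum>x\<leftarrow>xs. x ^ j)) =
      (\<Sum>j<p. of_nat (p choose j) * t ^ (p - j) * (\<Sum>y\<leftarrow>ys. y ^ j))"
    using p by (intro sum.cong refl) (simp add: eq)
  \<comment> \<open>The term \<open>j = p\<close>, with coefficient 1, is split off because
    \<open>eq\<close> says nothing about exponent \<open>p\<close> when
    \<open>p = Suc m\<close>.\<close>
  have split: "(\<Sum>z\<leftarrow>zs. (z + t) ^ p) =
      (\<Sum>j<p. of_nat (p choose j) * t ^ (p - j) * (\<Sum>z\<leftarrow>zs. z ^ j)) + (\<Sum>z\<leftarrow>zs. z ^ p)" for zs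
    by (simp add: sum_list_power_shift lessThan_Suc_atMost[symmetric])
  \<comment> \<open>Both sides are now the common lower part plus the \<open>p\<close>-th power sums
    of \<open>xs\<close> and \<open>ys\<close>; no subtraction occurs, so a semiring
    suffices.\<close>
  show ?thesis
    by (simp add: comp_def split lower add_ac)
qed

lemma xseq_yseq_power_sums_eq:
  assumes "a + b = c + d" and "p \<le> Suc m"
  shows "(\<Sum>x\<leftarrow>xseq a b c d k (Suc m). x ^ p) = (\<Sum>y\<leftarrow>yseq a b c d k (Suc m). y ^ p)"
  using assms(2)
proof (induction m arbitrary: p)
  case 0
  \<comment> \<open>Exponent 0 counts two entries on each side; exponent 1 is where
    \<open>a + b = c + d\<close> enters.\<close>
  then have "p = 0 \<or> p = 1" by auto
  then show ?case using assms(1) by auto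
next
  case (Suc m)
  then show ?case
    unfolding xseq.simps yseq.simps by (rule power_sums_eq_append_shift)
qed

lemma sum_nth_power_eq_sum_list:
  assumes "length xs = N"
  shows "(\<Sum>i = 1..N. (xs ! (i - 1)) ^ p) = (\<Sum>x\<leftarrow>xs. x ^ p)"
proof -
  have "(\<Sum>i = 1..N. (xs ! (i - 1)) ^ p) = (\<Sum>i<N. (xs ! i) ^ p)"
    by (rule sum.reindex_bij_witness[of _ Suc "\<lambda>i. i - 1"]) auto
  then show ?thesis
    using assms by (simp add: sum_list_sum_nth atLeast0LessThan)
qed

theorem theorem1:
  fixes a b c d :: real and k :: "nat \<Rightarrow> real" and n :: nat
  assumes "a + b = c + d" and "n \<ge> 1"
  shows "(\<Sum>i = 1..2 ^ n. (xseq a b c d k n ! (i - 1)) ^ n) =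
         (\<Sum>i = 1..2 ^ n. (yseq a b c d k n ! (i - 1)) ^ n)"
proof -
  obtain m where n: "n = Suc m" using assms(2) by (cases n) auto
  have "(\<Sum>x\<leftarrow>xseq a b c d k n. x ^ n) = (\<Sum>y\<leftarrow>yseq a b c d k n. y ^ n)"
    unfolding n using assms(1) by (rule xseq_yseq_power_sums_eq) simp
  then show ?thesis
    using length_xseq_yseq[OF assms(2), of a b c d k] by (simp only: sum_nth_power_eq_sum_list)
qed

end
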